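(* Let $A=[a_{ij}]$ be an $n\times n$ pairwise reciprocal matrix, let $r\in\mathbb{R}$ with $r\neq 0$, let $\tilde G=[\tilde g_{ij}]$ be the shifted Gram matrix of $A$ with parameter $r$, and let $w=\tilde v/(\tilde v e^T)$, with $\tilde v=e\tilde G^{-1}$, be the Normalized-IGM weight vector. Then $$w=\frac{\tilde v}{\tilde v e^T}=\frac{e\tilde G^{-1}}{e\tilde G^{-1}e^T}=\frac{e(\bar G+r)^{-1}}{e(\bar G+r)^{-1}e^T},$$ where, for all $i,j\in\{1,\ldots,n\}$, $$\tilde g_{ij}=r+\bar g_{ij}=\begin{cases} r+(n-1)+\sum_{k\neq i}a_{kj}^2, & i=j,\\ r-a_{ij}-a_{ji}, & i\neq j.\end{cases}$$
   Context: A pairwise reciprocal matrix (PRM) of size $n\ge 2$ is a real $n\times n$ matrix $A=[a_{ij}]$ with $0<a_{ij}=a_{ji}^{-1}$ for all $i,j\in\{1,\ldots,n\}$ (in particular $a_{ii}=1$). $e=(1,\ldots,1)$ denotes the row vector of ones of length $n$. $\bar D$ is the $n(n-1)\times n$ matrix whose rows are, for each pair $(i,j)$ with $1\le i<j\le n$ (in lexicographic order), the two rows: (i) the row with entry $1$ in column $i$, entry $-a_{ij}$ in column $j$ and $0$ elsewhere; (ii) the row with entry $-a_{ji}$ in column $i$, entry $1$ in column $j$ and $0$ elsewhere. Put $\bar G=[\bar g_{ij}]=\bar D^T\bar D$. The notation $\bar G+r$ means that the scalar $r$ is added to every entry of $\bar G$. Shifted Gram matrix: for $r>0$, $$\tilde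 G=\begin{bmatrix}\bar D\\ e\sqrt r\end{bmatrix}^T\begin{bmatrix}\bar D\\ e\sqrt r\end{bmatrix},$$ and for $r<0$, $$\tilde G=\begin{bmatrix}\bar D\\ e\sqrt{|r|}\end{bmatrix}^T\begin{bmatrix}\bar D\\ -e\sqrt{|r|}\end{bmatrix}.$$ The unnormalized Normalized-IGM (Normalized Inverse Gram Matrix) solution is the row vector $\tilde v=e\tilde G^{-1}$, and the Normalized-IGM weight vector is $w=\tilde v/(\tilde v e^T)$. *)

theory Defs
  imports Complex_Main "Jordan_Normal_Form.Gauss_Jordan_Elimination"
begin

text \<open>
  All vectors are matrices with one row or one column, as in the products
  \<open>e M\<close> and \<open>e M e\<^sup>T\<close>; a \<open>1 \<times> 1\<close> product such as \<open>v e\<^sup>T\<close> is read as a scalar through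
  its only entry. Indices run over \<open>0, \<dots>, n - 1\<close>.
\<close>

definition pairwise_reciprocal_matrix :: "nat \<Rightarrow> real mat \<Rightarrow> bool" where
  "pairwise_reciprocal_matrix n A \<longleftrightarrow>
     2 \<le> n \<and> A \<in> carrier_mat n n \<and>
     (\<forall>i<n. \<forall>j<n. 0 < A $$ (i,j) \<and> A $$ (i,j) = inverse (A $$ (j,i)))"

definition ones_row :: "nat \<Rightarrow> real mat" where
  "ones_row n = mat 1 n (\<lambda>_. 1)"

definition D_bar :: "nat \<Rightarrow> real mat \<Rightarrow> real mat" where
  "D_bar n A = mat_of_rows n (concat
     [[vec n (\<lambda>k. if k = i then 1 else if k = j then - A $$ (i,j) else 0),
       vec n (\<lambda>k. if k = i then - A $$ (j,i) else if k = j then 1 else 0)].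
      i \<leftarrow> [0..<n], j \<leftarrow> [Suc i..<n]])"

definition G_bar :: "nat \<Rightarrow> real mat \<Rightarrow> real mat" where
  "G_bar n A = (D_bar n A)\<^sup>T * D_bar n A"

definition add_to_entries :: "real mat \<Rightarrow> real \<Rightarrow> real mat" where
  "add_to_entries M r = map_mat (\<lambda>x. x + r) M"

text \<open>Only \<open>r \<noteq> 0\<close> is meaningful below; \<open>r = 0\<close> falls into the second branch and
  is excluded where the definition is used.\<close>

definition shifted_gram :: "nat \<Rightarrow> real mat \<Rightarrow> real \<Rightarrow> real mat" where
  "shifted_gram n A r =
     (if r > 0
      then (D_bar n A @\<^sub>r (sqrt r \<cdot>\<^sub>m ones_row n))\<^sup>T * (D_bar n A @\<^sub>r (sqrt r \<cdot>\<^sub>m ones_row n))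
      else (D_bar n A @\<^sub>r (sqrt \<bar>r\<bar> \<cdot>\<^sub>m ones_row n))\<^sup>T
             * (D_bar n A @\<^sub>r (- (sqrt \<bar>r\<bar> \<cdot>\<^sub>m ones_row n))))"

text \<open>The library function \<^const>\<open>mat_inverse\<close> returns \<^const>\<open>None\<close> exactly on singular
  (or non-square) matrices, where the value below is unspecified.\<close>

definition inv_mat :: "real mat \<Rightarrow> real mat" where
  "inv_mat M = the (mat_inverse M)"

definition igm_unnormalized :: "nat \<Rightarrow> real mat \<Rightarrow> real \<Rightarrow> real mat" where
  "igm_unnormalized n A r = ones_row n * inv_mat (shifted_gram n A r)"

definition igm_weights :: "nat \<Rightarrow> real mat \<Rightarrow> real \<Rightarrow> real mat" where
  "igm_weights n A r =
     (1 / (igm_unnormalized n A r * (ones_row n)\<^sup>T) $$ (0,0)) \<cdot>\<^sub>m igm_unnormalized n A r"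

end

theory Submission
  imports Defs
begin

text \<open>A Gram matrix is the sum of the outer squares of its rows. Summing over the list itself
  avoids computing positions in the \<open>concat\<close> that lists the rows of
  \<open>D_bar\<close>.\<close>

lemma index_gram_mat_of_rows:
  fixes us :: "'a :: comm_semiring_0 vec list"
  assumes "set us \<subseteq> carrier_vec n" "i < n" "j < n"
  shows "((mat_of_rows n us)\<^sup>T * mat_of_rows n us) $$ (i,j) = (\<Sum>u\<leftarrow>us. u $ i * u $ j)"
proof -
  have "((mat_of_rows n us)\<^sup>T * mat_of_rows n us) $$ (i,j)
      = (\<Sum>k = 0..<length us. us ! k $ i * us ! k $ j)"
    using assms by (simp add: scalar_prod_def mat_of_rows_index)
  then show ?thesis
    by (simp add: sum_list_sum_nth)
qed

text \<open>Block multiplication. The lower blocks may differ because the shifted Gram matrix for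
  negative \<open>r\<close> uses last rows of opposite sign.\<close>

lemma index_append_rows_transpose_mult:
  fixes B C :: "'a :: comm_semiring_0 mat"
  assumes "B \<in> carrier_mat m n" "C \<in> carrier_mat k n" "D \<in> carrier_mat k n" "i < n" "j < n"
  shows "((B @\<^sub>r C)\<^sup>T * (B @\<^sub>r D)) $$ (i,j) = (B\<^sup>T * B) $$ (i,j) + (C\<^sup>T * D) $$ (i,j)"
proof -
  have split: "sum f {0..<m + k} = sum f {0..<m} + (\<Sum>l = 0..<k. f (l + m))" for f :: "nat \<Rightarrow> 'a"
    using sum.atLeastLessThan_concat[of 0 m "m + k" f] sum.shift_bounds_nat_ivl[of f 0 m k]
    by (simp add: add.commute)
  have "((B @\<^sub>r C)\<^sup>T * (B @\<^sub>r D)) $$ (i,j)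
      = (\<Sum>l = 0..<m + k. (B @\<^sub>r C) $$ (l,i) * (B @\<^sub>r D) $$ (l,j))"
    using assms by (simp add: scalar_prod_def append_rows_def)
  also have "\<dots> = (\<Sum>l = 0..<m. (B @\<^sub>r C) $$ (l,i) * (B @\<^sub>r D) $$ (l,j))
      + (\<Sum>l = 0..<k. (B @\<^sub>r C) $$ (l + m,i) * (B @\<^sub>r D) $$ (l + m,j))"
    by (rule split)
  finally show ?thesis
    using assms by (simp add: scalar_prod_def append_rows_def)
qed

text \<open>Each ordered pair of distinct indices occurs exactly once on the left: as
  \<open>(p,q)\<close> if increasing, and as the swap of an increasing pair otherwise.\<close>

lemma sum_unordered_pairs:
  fixes h :: "nat \<Rightarrow> nat \<Rightarrow> 'a :: comm_monoid_add"
  shows "(\<Sum>p = 0..<n. \<Sum>q = Suc p..<n. h p q + h q p) = (\<Sum>p = 0..<n. \<Sum>q\<in>{0..<n} - {p}. h p q)"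
proof -
  have "(\<Sum>p = 0..<n. \<Sum>q = Suc p..<n. h q p) = (\<Sum>p = 0..<n. \<Sum>q = 0..<p. h p q)"
    \<comment> \<open>Both double sums become sums over triangles of index pairs, and the swap maps
      one triangle onto the other.\<close>
    by (subst (1 2) sum.Sigma; simp?) (rule sum.reindex_bij_witness[of _ prod.swap prod.swap]; auto)
  moreover have "(\<Sum>q\<in>{0..<n} - {p}. h p q) = (\<Sum>q = 0..<p. h p q) + (\<Sum>q = Suc p..<n. h p q)"
    if "p \<in> {0..<n}" for p
  proof -
    have "{0..<n} - {p} = {0..<p} \<union> {Suc p..<n}"
      using that by auto
    then show ?thesis
      by (simp add: sum.union_disjoint)
  qed
  ultimately show ?thesis
    by (simp add: sum.distrib add.commute)
qed

lemma sum_list_map_concat: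
  fixes g :: "'b \<Rightarrow> 'a :: monoid_add"
  shows "(\<Sum>x\<leftarrow>concat xss. g x) = (\<Sum>xs\<leftarrow>xss. \<Sum>x\<leftarrow>xs. g x)"
  by (induction xss) auto

text \<open>The row of \<^term>\<open>D_bar n A\<close> with entry \<open>1\<close> in column \<open>p\<close>; exchanging \<open>p\<close> and \<open>q\<close> exchanges
  the two rows belonging to a pair.\<close>

definition pair_row :: "nat \<Rightarrow> real mat \<Rightarrow> nat \<Rightarrow> nat \<Rightarrow> real vec" where
  "pair_row n A p q = vec n (\<lambda>k. if k = p then 1 else if k = q then - A $$ (p,q) else 0)"

lemma D_bar_pair_row:
  "D_bar n A = mat_of_rows n (concat
     [[pair_row n A p q, pair_row n A q p]. p \<leftarrow> [0..<n], q \<leftarrow> [Suc p..<n]])"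
  unfolding D_bar_def
  \<comment> \<open>\<open>pair_row n A q p\<close> tests column \<open>q\<close> before column
    \<open>p\<close>, the reverse of the second row in \<open>D_bar_def\<close>; they agree because
    \<open>p < q\<close>.\<close>
  by (intro arg_cong[of _ _ "mat_of_rows n"] arg_cong[of _ _ concat] map_cong refl)
    (auto simp: pair_row_def)

lemma index_G_bar_sum:
  assumes "i < n" "j < n"
  shows "G_bar n A $$ (i,j)
    = (\<Sum>p = 0..<n. \<Sum>q\<in>{0..<n} - {p}. pair_row n A p q $ i * pair_row n A p q $ j)"
proof -
  let ?us = "concat [[pair_row n A p q, pair_row n A q p]. p \<leftarrow> [0..<n], q \<leftarrow> [Suc p..<n]]"
  have "set ?us \<subseteq> carrier_vec n"
    by (auto simp: pair_row_def)
  then have "G_bar n A $$ (i,j) = (\<Sum>u\<leftarrow>?us. u $ i * u $ j)"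
    unfolding G_bar_def D_bar_pair_row using assms by (intro index_gram_mat_of_rows)
  also have "\<dots> = (\<Sum>p = 0..<n. \<Sum>q = Suc p..<n.
      pair_row n A p q $ i * pair_row n A p q $ j + pair_row n A q p $ i * pair_row n A q p $ j)"
    by (simp add: sum_list_map_concat comp_def interv_sum_list_conv_sum_set_nat)
  finally show ?thesis
    by (simp only: sum_unordered_pairs)
qed

text \<open>On the diagonal, the \<open>n - 1\<close> rows with \<open>p = i\<close> contribute 1
  each, and every other \<open>p\<close> contributes one square, from \<open>q = i\<close>. Off the
  diagonal, only the rows for \<open>(i,j)\<close> and \<open>(j,i)\<close> can be nonzero in both
  columns.\<close>

lemma index_G_bar:
  assumes "i < n" "j < n"
  shows "G_bar n A $$ (i,j) =
    (if i = j then (real n - 1) + (\<Sum>k\<in>{0..<n} - {i}. (A $$ (k,j))\<^sup>2)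
     else - A $$ (i,j) - A $$ (j,i))"
proof (cases "i = j")
  case True
  have "(\<Sum>q\<in>{0..<n} - {p}. pair_row n A p q $ i * pair_row n A p q $ j)
      = (if p = i then real n - 1 else (A $$ (p,i))\<^sup>2)" if "p \<in> {0..<n}" for p
  proof (cases "p = i")
    case True
    then show ?thesis
      using \<open>i = j\<close> assms by (simp add: pair_row_def of_nat_diff)
  next
    case False
    \<comment> \<open>For \<open>p \<noteq> i\<close> only the row with \<open>q = i\<close> reaches
      column \<open>i\<close>; the summand is written as a delta in \<open>q\<close> so that the sum
      collapses.\<close>
    then have "(\<Sum>q\<in>{0..<n} - {p}. pair_row n A p q $ i * pair_row n A p q $ j)
        = (\<Sum>q\<in>{0..<n} - {p}. if i = q then (A $$ (p,q))\<^sup>2 else 0)"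
      using \<open>i = j\<close> assms by (intro sum.cong) (auto simp: pair_row_def power2_eq_square)
    also have "\<dots> = (A $$ (p,i))\<^sup>2"
      using False assms by simp
    finally show ?thesis
      using False by simp
  qed
  then have "G_bar n A $$ (i,j)
      = (\<Sum>p = 0..<n. if p = i then real n - 1 else (A $$ (p,i))\<^sup>2)"
    using assms by (simp add: index_G_bar_sum)
  also have "\<dots> = (real n - 1) + (\<Sum>p\<in>{0..<n} - {i}. (A $$ (p,i))\<^sup>2)"
    using assms by (subst sum.remove[of _ i]) auto
  finally show ?thesis
    using True by simp
next
  case False
  have "(\<Sum>q\<in>{0..<n} - {p}. pair_row n A p q $ i * pair_row n A p q $ j)
      = (if p = i then - A $$ (i,j) else 0) + (if p = j then - A $$ (j,i) else 0)" for p
  proof -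
    \<comment> \<open>The two surviving rows, \<open>p = i, q = j\<close> and
      \<open>p = j, q = i\<close>, each become a delta in \<open>q\<close>.\<close>
    have "(\<Sum>q\<in>{0..<n} - {p}. pair_row n A p q $ i * pair_row n A p q $ j)
        = (\<Sum>q\<in>{0..<n} - {p}. (if j = q then (if p = i then - A $$ (i,j) else 0) else 0)
            + (if i = q then (if p = j then - A $$ (j,i) else 0) else 0))"
      using False assms by (intro sum.cong) (auto simp: pair_row_def)
    also have "\<dots> = (if p = i then - A $$ (i,j) else 0) + (if p = j then - A $$ (j,i) else 0)"
      using False assms by (simp add: sum.distrib)
    finally show ?thesis .
  qed
  then show ?thesis
    using False assms by (simp add: index_G_bar_sum sum.distrib)
qed

lemma dim_col_D_bar [simp]: "dim_col (D_bar n A) = n"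
  by (simp only: D_bar_def mat_of_rows_carrier)

lemma index_add_to_entries_G_bar:
  "i < n \<Longrightarrow> j < n \<Longrightarrow> add_to_entries (G_bar n A) r $$ (i,j) = r + G_bar n A $$ (i,j)"
  by (simp add: add_to_entries_def G_bar_def)

text \<open>The appended rows add the rank-one block whose entries are all
  \<open>sqrt \<bar>r\<bar>\<close> squared, taken with the sign of \<open>r\<close>, that is,
  \<open>r\<close> itself.\<close>

lemma shifted_gram_eq_add_to_entries: "shifted_gram n A r = add_to_entries (G_bar n A) r"
proof -
  define c where "c = sqrt \<bar>r\<bar> \<cdot>\<^sub>m ones_row n"
  \<comment> \<open>Putting the sign into \<open>d\<close> merges the two branches of
    \<open>shifted_gram\<close> into one product.\<close>
  define d where "d = (if r > 0 then c else - c)"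
  have c: "c \<in> carrier_mat 1 n" and d: "d \<in> carrier_mat 1 n"
    by (auto simp: c_def d_def ones_row_def)
  have gram: "shifted_gram n A r = (D_bar n A @\<^sub>r c)\<^sup>T * (D_bar n A @\<^sub>r d)"
    by (simp add: shifted_gram_def c_def d_def)
  have "(c\<^sup>T * d) $$ (i,j) = r" if "i < n" "j < n" for i j
    using that by (simp add: c_def d_def ones_row_def scalar_prod_def)
  moreover obtain m where "D_bar n A \<in> carrier_mat m n"
    using carrier_matI[OF refl dim_col_D_bar] by blast
  ultimately have "shifted_gram n A r $$ (i,j) = add_to_entries (G_bar n A) r $$ (i,j)"
    if "i < n" "j < n" for i j
    \<comment> \<open>Without \<open>index_mult_mat\<close>, entries of products stay folded, so the
      block rule and the folded \<open>G_bar_def\<close> can match.\<close>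
    using that by (simp add: gram index_append_rows_transpose_mult[OF _ c d]
        index_add_to_entries_G_bar G_bar_def[symmetric] del: index_mult_mat)
  then show ?thesis
    using c d
    by (intro eq_matI) (auto simp: gram add_to_entries_def G_bar_def append_rows_def)
qed

theorem theorem3:
  fixes n :: nat and A :: "real mat" and r :: real
  defines "e \<equiv> ones_row n"
  defines "v \<equiv> igm_unnormalized n A r"
  defines "w \<equiv> igm_weights n A r"
  defines "G \<equiv> shifted_gram n A r"
  defines "Gr \<equiv> add_to_entries (G_bar n A) r"
  assumes "pairwise_reciprocal_matrix n A"
    and "r \<noteq> 0"
  shows "w = (1 / (v * e\<^sup>T) $$ (0,0)) \<cdot>\<^sub>m v
       \<and> w = (1 / (e * inv_mat G * e\<^sup>T) $$ (0,0)) \<cdot>\<^sub>m (e * inv_mat G)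
       \<and> w = (1 / (e * inv_mat Gr * e\<^sup>T) $$ (0,0)) \<cdot>\<^sub>m (e * inv_mat Gr)
       \<and> (\<forall>i<n. \<forall>j<n.
            G $$ (i,j) = r + G_bar n A $$ (i,j)
          \<and> r + G_bar n A $$ (i,j) =
              (if i = j then r + (real n - 1) + (\<Sum>k\<in>{0..<n} - {i}. (A $$ (k,j))\<^sup>2)
               else r - A $$ (i,j) - A $$ (j,i)))"
proof -
  \<comment> \<open>The formula with \<open>Gr\<close> is the one with \<open>G\<close> rewritten by
    this equality of matrices, so the inverses are never computed.\<close>
  have GGr: "G = Gr"
    unfolding G_def Gr_def by (rule shifted_gram_eq_add_to_entries)
  have w: "w = (1 / (e * inv_mat G * e\<^sup>T) $$ (0,0)) \<cdot>\<^sub>m (e * inv_mat G)"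
    unfolding w_def e_def G_def igm_weights_def igm_unnormalized_def ..
  have "G $$ (i,j) = r + G_bar n A $$ (i,j)" if "i < n" "j < n" for i j
    using that unfolding GGr Gr_def by (rule index_add_to_entries_G_bar)
  moreover have "w = (1 / (v * e\<^sup>T) $$ (0,0)) \<cdot>\<^sub>m v"
    unfolding w_def v_def e_def igm_weights_def ..
  ultimately show ?thesis
    using w unfolding GGr by (simp add: index_G_bar)
qed

end
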